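(* Let $n\ge3$. For a lattice $\mathbf L$ let $\mathbf L^r$ be the algebra on $L$ with ternary operations $t_1(x,y,z)=x(y+z)$, $t_h(x,y,z)=xz$ for $2\le h\le n-2$, $t_{n-1}(x,y,z)=z(y+x)$. Let $\mathbf C_k$ be the $k$-element chain $\{0,\dots,k-1\}$ and put $\mathbf A_1=\mathbf A_2=\mathbf C_4^r$, $\mathbf A_3=\mathbf C_2^r$ (with distinguished element $0$). Let $\mathbf A_4$ be an algebra with only ternary operations $t_1,\dots,t_{n-1}$ such that $t_1$ is the first projection, $t_{n-1}$ the third projection and $t_h(x,y,x)=x$ for $2\le h\le n-2$. For $a,d\in A_4$ let $\mathbf B(a,d)$ be the subalgebra of $\mathbf A_1\times\mathbf A_2\times\mathbf A_3\times\mathbf A_4$ with universe the set of elements having at least one of the forms $(\ast,0,\ast,a)$, $(0,0,\ast,\ast)$, $(0,\ast,\ast,d)$, $(\ast,\ast,0,\ast)$. If $\chi$ is a term in the operations $\circ,\cap$ and there are congruences $\tilde\alpha,\tilde\beta,\tilde\gamma$ of $\mathbf A_4$ for which the inclusion $\tilde\alpha(\tilde\beta\circ\tilde\alpha\tilde\gamma\circ\tilde\beta)\subseteq\chi(\tilde\alpha,\tilde\beta,\tilde\gamma)$ fails, then there are $a,d\in A_4$ and congruences $\alpha,\beta,\gamma$ of $\mathbf B=\mathbf B(a,d)$ such that $$\alpha(\beta\circ\alpha\gamma\circ\beta)\subseteq\gamma\circ\alpha\beta\circ\gamma\circ\chi(\alpha,\beta,\gamma)\circ\gamma\circ\alpha\beta\circ\gamma$$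 fails in $\mathbf B$. In particular, if for some odd $r$ the inclusion $\tilde\alpha(\tilde\beta\circ\tilde\alpha\tilde\gamma\circ\tilde\beta)\subseteq\tilde\alpha\tilde\beta\circ\tilde\alpha\tilde\gamma\circ\stackrel{r}{\dots}\circ\tilde\alpha\tilde\beta$ fails in $\mathbf A_4$, then $\alpha(\beta\circ\alpha\gamma\circ\beta)\subseteq\alpha\gamma\circ\alpha\beta\circ\stackrel{r+6}{\dots}\circ\alpha\gamma$ fails in some such $\mathbf B$.
   Context: Lattice operations are denoted by juxtaposition (meet) and $+$ (join); for relations, juxtaposition denotes intersection and $\circ$ composition. $X\circ Y\circ\stackrel{k}{\dots}\circ Z$ is the alternating composition $X\circ Y\circ X\circ\cdots$ with $k$ factors, last factor $Z$. The set $B(a,d)$ is a subuniverse under these hypotheses. *)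

theory Defs
  imports Main
begin

text \<open>Algebras of type (3,...,3) with ternary operations t_1,...,t_{n-1}: a carrier set S and
  a family F of ternary operations, where F h is t_h (only indices 1 \<le> h \<le> n-1 matter).\<close>

definition algebra :: "nat \<Rightarrow> 'a set \<Rightarrow> (nat \<Rightarrow> 'a \<Rightarrow> 'a \<Rightarrow> 'a \<Rightarrow> 'a) \<Rightarrow> bool" where
  "algebra n S F \<longleftrightarrow> (\<forall>h. 1 \<le> h \<and> h \<le> n - 1 \<longrightarrow>
      (\<forall>x\<in>S. \<forall>y\<in>S. \<forall>z\<in>S. F h x y z \<in> S))"

definition congruence :: "nat \<Rightarrow> 'a set \<Rightarrow> (nat \<Rightarrow> 'a \<Rightarrow> 'a \<Rightarrow> 'a \<Rightarrow> 'a) \<Rightarrow> ('a \<times> 'a) set \<Rightarrow> bool" where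
  "congruence n S F \<theta> \<longleftrightarrow> equiv S \<theta> \<and>
     (\<forall>h. 1 \<le> h \<and> h \<le> n - 1 \<longrightarrow>
       (\<forall>x y z x' y' z'. (x, x') \<in> \<theta> \<longrightarrow> (y, y') \<in> \<theta> \<longrightarrow> (z, z') \<in> \<theta> \<longrightarrow>
          (F h x y z, F h x' y' z') \<in> \<theta>))"

text \<open>Operations of L^r for L a chain {0,...,k-1} of naturals (meet = min, join = max).\<close>

definition lat_op :: "nat \<Rightarrow> nat \<Rightarrow> nat \<Rightarrow> nat \<Rightarrow> nat \<Rightarrow> nat" where
  "lat_op n h x y z =
     (if h = 1 then min x (max y z) else if h = n - 1 then min z (max y x) else min x z)"

definition prod_op :: "nat \<Rightarrow> (nat \<Rightarrow> 'a \<Rightarrow> 'a \<Rightarrow> 'a \<Rightarrow> 'a) \<Rightarrow> nat \<Rightarrow>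
    nat \<times> nat \<times> nat \<times> 'a \<Rightarrow> nat \<times> nat \<times> nat \<times> 'a \<Rightarrow> nat \<times> nat \<times> nat \<times> 'a \<Rightarrow> nat \<times> nat \<times> nat \<times> 'a" where
  "prod_op n T h = (\<lambda>(x1, x2, x3, x4) (y1, y2, y3, y4) (z1, z2, z3, z4).
      (lat_op n h x1 y1 z1, lat_op n h x2 y2 z2, lat_op n h x3 y3 z3, T h x4 y4 z4))"

definition Bset :: "'a set \<Rightarrow> 'a \<Rightarrow> 'a \<Rightarrow> (nat \<times> nat \<times> nat \<times> 'a) set" where
  "Bset A4 a d = {(x1, x2, x3, x4). x1 \<in> {0..<4} \<and> x2 \<in> {0..<4} \<and> x3 \<in> {0..<2} \<and> x4 \<in> A4 \<and>
      ((x2 = 0 \<and> x4 = a) \<or> (x1 = 0 \<and> x2 = 0) \<or> (x1 = 0 \<and> x4 = d) \<or> x3 = 0)}"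

datatype rterm = VarA | VarB | VarG | Comp rterm rterm | Meet rterm rterm

fun rt_eval :: "rterm \<Rightarrow> ('b \<times> 'b) set \<Rightarrow> ('b \<times> 'b) set \<Rightarrow> ('b \<times> 'b) set \<Rightarrow> ('b \<times> 'b) set" where
  "rt_eval VarA a b c = a"
| "rt_eval VarB a b c = b"
| "rt_eval VarG a b c = c"
| "rt_eval (Comp s t) a b c = rt_eval s a b c O rt_eval t a b c"
| "rt_eval (Meet s t) a b c = rt_eval s a b c \<inter> rt_eval t a b c"

fun alt :: "('b \<times> 'b) set \<Rightarrow> ('b \<times> 'b) set \<Rightarrow> nat \<Rightarrow> ('b \<times> 'b) set" where
  "alt X Y 0 = Id"
| "alt X Y (Suc 0) = X"
| "alt X Y (Suc (Suc k)) = X O alt Y X (Suc k)"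

end

theory Submission
  imports Defs
begin

text \<open>
  Choose \<open>(a, d)\<close> violating the inclusion in \<open>A4\<close>, witnessed by \<open>a \<beta>' b \<alpha>'\<gamma>' c \<beta>' d\<close>. On \<open>C\<^sub>4\<close> let
  \<open>\<beta>\<close> have blocks \<open>{0,1},{2,3}\<close>, let \<open>\<gamma>\<close> have blocks \<open>{0},{1,2},{3}\<close> and let \<open>\<alpha>\<close> be total; on \<open>C\<^sub>2\<close>
  let \<open>\<beta>\<close> be total and \<open>\<alpha>\<close>, \<open>\<gamma>\<close> trivial. In \<open>B(a, d)\<close> the path
  \<open>(3,0,1,a), (2,1,0,b), (1,2,0,c), (0,3,1,d)\<close> shows that the two endpoints lie in the left-hand side.
  On the right-hand side, a factor \<open>\<gamma>\<close> or \<open>\<alpha>\<beta>\<close> preserves the third coordinate \<open>1\<close>; as long as the first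
  coordinate is nonzero, membership in \<open>B(a, d)\<close> then forces the shape \<open>(\<ast>,0,1,a)\<close>. Three steps of
  \<open>\<gamma>, \<alpha>\<beta>, \<gamma>\<close> cannot bring the first coordinate from \<open>3\<close> to \<open>0\<close>. Symmetrically from the other
  end, so \<open>\<chi>\<close> would have to relate \<open>(\<ast>,0,1,a)\<close> to \<open>(0,\<ast>,1,d)\<close>, hence \<open>a\<close> to \<open>d\<close> in \<open>A4\<close>.
\<close>

text \<open>A monotone map between chains preserves min and max. Hence its kernel is compatible with
  \<open>lat_op\<close>, and a congruence of a chain can be given by a monotone map.\<close>

lemma lat_op_mono_commute:
  fixes f :: "nat \<Rightarrow> nat"
  assumes "mono f"
  shows "f (lat_op n h x y z) = lat_op n h (f x) (f y) (f z)"
  using assms by (simp add: lat_op_def min_of_mono max_of_mono)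

lemma lat_op_less:
  assumes "x < k" "z < k"
  shows "lat_op n h x y z < k"
  using assms by (auto simp: lat_op_def)

lemma algebra_Bset:
  assumes alg: "algebra n A4 T"
    and t1: "\<forall>x\<in>A4. \<forall>y\<in>A4. \<forall>z\<in>A4. T 1 x y z = x"
    and tn: "\<forall>x\<in>A4. \<forall>y\<in>A4. \<forall>z\<in>A4. T (n - 1) x y z = z"
    and th: "\<forall>h. 2 \<le> h \<and> h \<le> n - 2 \<longrightarrow> (\<forall>x\<in>A4. \<forall>y\<in>A4. T h x y x = x)"
  shows "algebra n (Bset A4 a d) (prod_op n T)"
  unfolding algebra_def
proof (intro allI impI ballI, elim conjE)
  fix h x y z
  assume h: "1 \<le> h" "h \<le> n - 1"
    and B: "x \<in> Bset A4 a d" "y \<in> Bset A4 a d" "z \<in> Bset A4 a d"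
  obtain x1 x2 x3 x4 y1 y2 y3 y4 z1 z2 z3 z4
    where eq: "x = (x1, x2, x3, x4)" "y = (y1, y2, y3, y4)" "z = (z1, z2, z3, z4)"
    by (metis prod.exhaust)
  have mem: "x4 \<in> A4" "y4 \<in> A4" "z4 \<in> A4"
    using B by (auto simp: eq Bset_def)
  have x: "x2 = 0 \<and> x4 = a \<or> x1 = 0 \<and> x2 = 0 \<or> x1 = 0 \<and> x4 = d \<or> x3 = 0"
    and z: "z2 = 0 \<and> z4 = a \<or> z1 = 0 \<and> z2 = 0 \<or> z1 = 0 \<and> z4 = d \<or> z3 = 0"
    using B by (simp_all add: eq Bset_def)
  have T: "T h x4 y4 z4 \<in> A4"
    using alg h mem by (auto simp: algebra_def)
  have range: "lat_op n h x1 y1 z1 < 4" "lat_op n h x2 y2 z2 < 4" "lat_op n h x3 y3 z3 < 2"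
    using B by (auto simp: eq Bset_def intro!: lat_op_less)
  consider "h = 1" | "h = n - 1" "h \<noteq> 1" | "h \<noteq> 1" "h \<noteq> n - 1" "2 \<le> h" "h \<le> n - 2"
    using h by linarith
  then show "prod_op n T h x y z \<in> Bset A4 a d"
  proof cases
    case 1
    then have "T h x4 y4 z4 = x4" "\<And>v w. lat_op n h 0 v w = 0"
      using t1 mem by (simp_all add: lat_op_def)
    then show ?thesis
      using x T range unfolding eq prod_op_def by (elim disjE) (simp_all add: Bset_def)
  next
    case 2
    then have "T h x4 y4 z4 = z4" "\<And>v w. lat_op n h w v 0 = 0"
      using tn mem by (simp_all add: lat_op_def)
    then show ?thesis
      using z T range unfolding eq prod_op_def by (elim disjE) (simp_all add: Bset_def)
  next
    case 3
    then have "x4 = z4 \<Longrightarrow> T h x4 y4 z4 = x4"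
      and "\<And>v w. lat_op n h 0 v w = 0" "\<And>v w. lat_op n h w v 0 = 0"
      using th mem by (simp_all add: lat_op_def)
    then show ?thesis
      using x z T range unfolding eq prod_op_def by (elim disjE) (simp_all add: Bset_def)
  qed
qed

text \<open>This restricts a product congruence to B(a,d), with lattice factors encoded as kernels:
  \<open>f\<close> on both copies of C_4, \<open>g\<close> on C_2. A constant map gives the total
  congruence, \<open>id\<close> the trivial one.\<close>

definition Bcong :: "'a set \<Rightarrow> 'a \<Rightarrow> 'a \<Rightarrow> (nat \<Rightarrow> nat) \<Rightarrow> (nat \<Rightarrow> nat) \<Rightarrow> ('a \<times> 'a) set \<Rightarrow>
    ((nat \<times> nat \<times> nat \<times> 'a) \<times> (nat \<times> nat \<times> nat \<times> 'a)) set" where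
  "Bcong A4 a d f g \<theta> = {((x1, x2, x3, x4), (y1, y2, y3, y4)).
     (x1, x2, x3, x4) \<in> Bset A4 a d \<and> (y1, y2, y3, y4) \<in> Bset A4 a d \<and>
     f x1 = f y1 \<and> f x2 = f y2 \<and> g x3 = g y3 \<and> (x4, y4) \<in> \<theta>}"

lemma congruence_Bcong:
  assumes B: "algebra n (Bset A4 a d) (prod_op n T)"
    and \<theta>: "congruence n A4 T \<theta>"
    and mono: "mono f" "mono g"
  shows "congruence n (Bset A4 a d) (prod_op n T) (Bcong A4 a d f g \<theta>)"
  unfolding congruence_def
proof (intro conjI allI impI)
  have eq: "equiv A4 \<theta>"
    using \<theta> by (simp add: congruence_def)
  show "equiv (Bset A4 a d) (Bcong A4 a d f g \<theta>)"
  proof (rule equivI)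
    show "Bcong A4 a d f g \<theta> \<subseteq> Bset A4 a d \<times> Bset A4 a d"
      by (auto simp: Bcong_def)
    show "refl_on (Bset A4 a d) (Bcong A4 a d f g \<theta>)"
      using eq by (auto simp: Bcong_def Bset_def refl_on_def equiv_def)
    show "sym (Bcong A4 a d f g \<theta>)"
      using eq by (auto simp: Bcong_def equiv_def intro!: symI dest: symD)
    show "trans (Bcong A4 a d f g \<theta>)"
      using eq by (auto simp: Bcong_def equiv_def intro!: transI dest: transD)
  qed
next
  fix h x y z x' y' z'
  assume h: "1 \<le> h \<and> h \<le> n - 1"
    and x: "(x, x') \<in> Bcong A4 a d f g \<theta>"
    and y: "(y, y') \<in> Bcong A4 a d f g \<theta>"
    and z: "(z, z') \<in> Bcong A4 a d f g \<theta>"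
  have "prod_op n T h x y z \<in> Bset A4 a d" "prod_op n T h x' y' z' \<in> Bset A4 a d"
    using B h x y z by (auto simp: algebra_def Bcong_def)
  then show "(prod_op n T h x y z, prod_op n T h x' y' z') \<in> Bcong A4 a d f g \<theta>"
    using \<theta> h x y z
    by (auto simp: Bcong_def prod_op_def congruence_def lat_op_mono_commute mono)
qed

text \<open>Projection to the fourth coordinate sends a composition into the composition of the
  images and an intersection into their intersection, so induction on the term applies.\<close>

lemma rt_eval_Bcong:
  assumes "((x1, x2, x3, x4), (y1, y2, y3, y4)) \<in>
      rt_eval \<chi> (Bcong A4 a d f g \<alpha>') (Bcong A4 a d f' g' \<beta>') (Bcong A4 a d f'' g'' \<gamma>')"
  shows "(x4, y4) \<in> rt_eval \<chi> \<alpha>' \<beta>' \<gamma>'"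
  using assms
proof (induction \<chi> arbitrary: x1 x2 x3 x4 y1 y2 y3 y4)
  case (Comp s t)
  then show ?case
    by fastforce
qed (auto simp: Bcong_def)

text \<open>On {0,1,2,3}, \<open>i div 2\<close> has the blocks {0,1},{2,3} and
  \<open>Suc i div 2\<close> the blocks {0},{1,2},{3}. The relations take \<open>a\<close> and
  \<open>d\<close> as parameters because these come only from the failing inclusion.\<close>

lemma Bcong_inclusion_fails:
  fixes A4 :: "'a set" and \<alpha>' \<beta>' \<gamma>' :: "('a \<times> 'a) set"
  defines "\<alpha> a d \<equiv> Bcong A4 a d (\<lambda>_. 0) id \<alpha>'"
    and "\<beta> a d \<equiv> Bcong A4 a d (\<lambda>i. i div 2) (\<lambda>_. 0) \<beta>'"
    and "\<gamma> a d \<equiv> Bcong A4 a d (\<lambda>i. Suc i div 2) id \<gamma>'"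
  assumes equiv: "equiv A4 \<alpha>'" "equiv A4 \<beta>'" "equiv A4 \<gamma>'"
    and fails: "\<not> \<alpha>' \<inter> (\<beta>' O (\<alpha>' \<inter> \<gamma>') O \<beta>') \<subseteq> rt_eval \<chi> \<alpha>' \<beta>' \<gamma>'"
  shows "\<exists>a\<in>A4. \<exists>d\<in>A4.
    \<not> \<alpha> a d \<inter> (\<beta> a d O (\<alpha> a d \<inter> \<gamma> a d) O \<beta> a d) \<subseteq>
      \<gamma> a d O (\<alpha> a d \<inter> \<beta> a d) O \<gamma> a d O rt_eval \<chi> (\<alpha> a d) (\<beta> a d) (\<gamma> a d) O
      \<gamma> a d O (\<alpha> a d \<inter> \<beta> a d) O \<gamma> a d"
proof -
  from fails obtain a b c d where rel: "(a, d) \<in> \<alpha>'" "(a, b) \<in> \<beta>'" "(b, c) \<in> \<alpha>'" "(b, c) \<in> \<gamma>'"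
      "(c, d) \<in> \<beta>'" and ad: "(a, d) \<notin> rt_eval \<chi> \<alpha>' \<beta>' \<gamma>'"
    by blast
  have mem: "a \<in> A4" "b \<in> A4" "c \<in> A4" "d \<in> A4"
    using rel equiv by (auto simp: equiv_def)
  note defs = \<alpha>_def \<beta>_def \<gamma>_def Bcong_def Bset_def
  let ?e = "(3, 0, 1, a) :: nat \<times> nat \<times> nat \<times> 'a" and ?e' = "(0, 3, 1, d) :: nat \<times> nat \<times> nat \<times> 'a"
  \<comment> \<open>The inner points of the path have third coordinate 0, so they lie in B(a,d)
    whatever \<open>b\<close> and \<open>c\<close> are; \<beta> can reach them because it is total
    on C_2.\<close>
  have "(?e, ?e') \<in> \<alpha> a d"
    using rel mem by (simp add: defs)
  moreover have "(?e, (2, 1, 0, b)) \<in> \<beta> a d"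
    using rel mem by (simp add: defs)
  moreover have "((2, 1, 0, b), (1, 2, 0, c)) \<in> \<alpha> a d \<inter> \<gamma> a d"
    using rel mem by (simp add: defs)
  moreover have "((1, 2, 0, c), ?e') \<in> \<beta> a d"
    using rel mem by (simp add: defs)
  ultimately have lhs: "(?e, ?e') \<in> \<alpha> a d \<inter> (\<beta> a d O (\<alpha> a d \<inter> \<gamma> a d) O \<beta> a d)"
    by blast
  \<comment> \<open>The first coordinate stays at 3, a singleton \<gamma>-block, then stays in
    {2,3}, then in {1,2,3}: it never reaches 0.\<close>
  have left: "\<exists>p. v = (p, 0, 1, a)" if uv: "(?e, u) \<in> \<gamma> a d" "(u, w) \<in> \<alpha> a d \<inter> \<beta> a d" "(w, v) \<in> \<gamma> a d"
    for u v w
  proof -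
    have "u = (3, 0, 1, a)"
      using uv(1) by (auto simp: defs)
    with uv(2) obtain p where p: "w = (p, 0, 1, a)" "p \<ge> 2"
      by (auto simp: defs)
    with uv(3) show ?thesis
      by (auto simp: defs)
  qed
  \<comment> \<open>Mirror image, read from the right end: the first two coordinates swap roles, and
    \<open>d\<close> replaces \<open>a\<close>.\<close>
  have right: "\<exists>q. v = (0, q, 1, d)" if uv: "(v, w) \<in> \<gamma> a d" "(w, u) \<in> \<alpha> a d \<inter> \<beta> a d" "(u, ?e') \<in> \<gamma> a d"
    for u v w
  proof -
    have "u = (0, 3, 1, d)"
      using uv(3) by (auto simp: defs)
    with uv(2) obtain q where q: "w = (0, q, 1, d)" "q \<ge> 2"
      by (auto simp: defs)
    with uv(1) show ?thesis
      by (auto simp: defs)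
  qed
  have "(?e, ?e') \<notin> \<gamma> a d O (\<alpha> a d \<inter> \<beta> a d) O \<gamma> a d O rt_eval \<chi> (\<alpha> a d) (\<beta> a d) (\<gamma> a d) O
      \<gamma> a d O (\<alpha> a d \<inter> \<beta> a d) O \<gamma> a d"
  proof
    assume "(?e, ?e') \<in> \<gamma> a d O (\<alpha> a d \<inter> \<beta> a d) O \<gamma> a d O rt_eval \<chi> (\<alpha> a d) (\<beta> a d) (\<gamma> a d) O
      \<gamma> a d O (\<alpha> a d \<inter> \<beta> a d) O \<gamma> a d"
    then obtain u w v v' w' u' where
      "(?e, u) \<in> \<gamma> a d" "(u, w) \<in> \<alpha> a d \<inter> \<beta> a d" "(w, v) \<in> \<gamma> a d"
      and \<chi>: "(v, v') \<in> rt_eval \<chi> (\<alpha> a d) (\<beta> a d) (\<gamma> a d)"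
      and "(v', w') \<in> \<gamma> a d" "(w', u') \<in> \<alpha> a d \<inter> \<beta> a d" "(u', ?e') \<in> \<gamma> a d"
      by (elim relcompEpair) blast
    then obtain p q where "v = (p, 0, 1, a)" "v' = (0, q, 1, d)"
      using left right by meson
    with \<chi> have "(a, d) \<in> rt_eval \<chi> \<alpha>' \<beta>' \<gamma>'"
      unfolding \<alpha>_def \<beta>_def \<gamma>_def by (blast dest: rt_eval_Bcong)
    with ad show False ..
  qed
  with lhs mem show ?thesis
    by blast
qed

text \<open>Index \<open>k\<close> yields k + 1 factors, since no term denotes the empty composition
  \<open>Id\<close>.\<close>

fun alt_term :: "rterm \<Rightarrow> rterm \<Rightarrow> nat \<Rightarrow> rterm" where
  "alt_term s t 0 = s"
| "alt_term s t (Suc k) = Comp s (alt_term t s k)"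

lemma rt_eval_alt_term:
  "rt_eval (alt_term s t k) \<alpha> \<beta> \<gamma> = alt (rt_eval s \<alpha> \<beta> \<gamma>) (rt_eval t \<alpha> \<beta> \<gamma>) (Suc k)"
  by (induction k arbitrary: s t) simp_all

lemma alt_Suc: "alt X Y (Suc k) = X O alt Y X k"
  by (cases k) simp_all

lemma alt_add:
  "alt X Y (j + k) = alt X Y j O (if even j then alt X Y k else alt Y X k)"
  by (induction j arbitrary: X Y) (simp_all add: alt_Suc O_assoc)

text \<open>Split as 3 + r + 3: each of the three pieces has odd length, so the middle one starts
  with \<open>Y\<close> and the last with \<open>X\<close> again.\<close>

lemma alt_add_six:
  assumes "odd r"
  shows "alt X Y (r + 6) = X O Y O X O alt Y X r O X O Y O X"
proof -
  have "alt X Y (r + 6) = alt X Y (3 + (r + 3))"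
    by (simp add: add.commute)
  also have "\<dots> = alt X Y 3 O alt Y X r O alt X Y 3"
    using assms by (simp only: alt_add) simp
  finally show ?thesis
    by (simp add: numeral_3_eq_3 O_assoc)
qed

theorem theorem3p5:
  fixes n :: nat and A4 :: "'a set" and T :: "nat \<Rightarrow> 'a \<Rightarrow> 'a \<Rightarrow> 'a \<Rightarrow> 'a"
  assumes n3: "n \<ge> 3"
    and alg: "algebra n A4 T"
    and t1: "\<forall>x\<in>A4. \<forall>y\<in>A4. \<forall>z\<in>A4. T 1 x y z = x"
    and tn: "\<forall>x\<in>A4. \<forall>y\<in>A4. \<forall>z\<in>A4. T (n - 1) x y z = z"
    and th: "\<forall>h. 2 \<le> h \<and> h \<le> n - 2 \<longrightarrow> (\<forall>x\<in>A4. \<forall>y\<in>A4. T h x y x = x)"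
  shows "(\<forall>\<chi>. (\<exists>\<alpha>' \<beta>' \<gamma>'. congruence n A4 T \<alpha>' \<and> congruence n A4 T \<beta>' \<and> congruence n A4 T \<gamma>' \<and>
              \<not> (\<alpha>' \<inter> (\<beta>' O (\<alpha>' \<inter> \<gamma>') O \<beta>') \<subseteq> rt_eval \<chi> \<alpha>' \<beta>' \<gamma>')) \<longrightarrow>
           (\<exists>a\<in>A4. \<exists>d\<in>A4. \<exists>\<alpha> \<beta> \<gamma>.
              congruence n (Bset A4 a d) (prod_op n T) \<alpha> \<and>
              congruence n (Bset A4 a d) (prod_op n T) \<beta> \<and>
              congruence n (Bset A4 a d) (prod_op n T) \<gamma> \<and>
              \<not> (\<alpha> \<inter> (\<beta> O (\<alpha> \<inter> \<gamma>) O \<beta>) \<subseteq>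
                   \<gamma> O (\<alpha> \<inter> \<beta>) O \<gamma> O rt_eval \<chi> \<alpha> \<beta> \<gamma> O \<gamma> O (\<alpha> \<inter> \<beta>) O \<gamma>)))
       \<and> (\<forall>r. odd r \<longrightarrow>
           (\<exists>\<alpha>' \<beta>' \<gamma>'. congruence n A4 T \<alpha>' \<and> congruence n A4 T \<beta>' \<and> congruence n A4 T \<gamma>' \<and>
              \<not> (\<alpha>' \<inter> (\<beta>' O (\<alpha>' \<inter> \<gamma>') O \<beta>') \<subseteq> alt (\<alpha>' \<inter> \<beta>') (\<alpha>' \<inter> \<gamma>') r)) \<longrightarrow>
           (\<exists>a\<in>A4. \<exists>d\<in>A4. \<exists>\<alpha> \<beta> \<gamma>.
              congruence n (Bset A4 a d) (prod_op n T) \<alpha> \<and>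
              congruence n (Bset A4 a d) (prod_op n T) \<beta> \<and>
              congruence n (Bset A4 a d) (prod_op n T) \<gamma> \<and>
              \<not> (\<alpha> \<inter> (\<beta> O (\<alpha> \<inter> \<gamma>) O \<beta>) \<subseteq> alt (\<alpha> \<inter> \<gamma>) (\<alpha> \<inter> \<beta>) (r + 6))))"
proof -
  have main: "\<exists>a\<in>A4. \<exists>d\<in>A4. \<exists>\<alpha> \<beta> \<gamma>.
      congruence n (Bset A4 a d) (prod_op n T) \<alpha> \<and>
      congruence n (Bset A4 a d) (prod_op n T) \<beta> \<and>
      congruence n (Bset A4 a d) (prod_op n T) \<gamma> \<and>
      \<not> (\<alpha> \<inter> (\<beta> O (\<alpha> \<inter> \<gamma>) O \<beta>) \<subseteq>
           \<gamma> O (\<alpha> \<inter> \<beta>) O \<gamma> O rt_eval \<chi> \<alpha> \<beta> \<gamma> O \<gamma> O (\<alpha> \<inter> \<beta>) O \<gamma>)"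
    if cong: "congruence n A4 T \<alpha>'" "congruence n A4 T \<beta>'" "congruence n A4 T \<gamma>'"
      and fails: "\<not> \<alpha>' \<inter> (\<beta>' O (\<alpha>' \<inter> \<gamma>') O \<beta>') \<subseteq> rt_eval \<chi> \<alpha>' \<beta>' \<gamma>'"
    for \<chi> \<alpha>' \<beta>' \<gamma>'
  proof -
    have mono: "mono (\<lambda>_::nat. 0::nat)" "mono (id :: nat \<Rightarrow> nat)" "mono (\<lambda>i::nat. i div 2)"
        "mono (\<lambda>i::nat. Suc i div 2)"
      by (auto intro!: monoI div_le_mono)
    note Bcong = congruence_Bcong[OF algebra_Bset[OF alg t1 tn th]]
    have "equiv A4 \<alpha>'" "equiv A4 \<beta>'" "equiv A4 \<gamma>'"
      using cong by (simp_all add: congruence_def)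
    from Bcong_inclusion_fails[OF this fails] show ?thesis
      using Bcong[OF cong(1) mono(1,2)] Bcong[OF cong(2) mono(3,1)] Bcong[OF cong(3) mono(4,2)]
      by meson
  qed
  show ?thesis
  proof (intro conjI allI impI; elim exE conjE)
    fix \<chi> \<alpha>' \<beta>' \<gamma>'
    assume "congruence n A4 T \<alpha>'" "congruence n A4 T \<beta>'" "congruence n A4 T \<gamma>'"
      "\<not> \<alpha>' \<inter> (\<beta>' O (\<alpha>' \<inter> \<gamma>') O \<beta>') \<subseteq> rt_eval \<chi> \<alpha>' \<beta>' \<gamma>'"
    then show "\<exists>a\<in>A4. \<exists>d\<in>A4. \<exists>\<alpha> \<beta> \<gamma>.
      congruence n (Bset A4 a d) (prod_op n T) \<alpha> \<and>
      congruence n (Bset A4 a d) (prod_op n T) \<beta> \<and>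
      congruence n (Bset A4 a d) (prod_op n T) \<gamma> \<and>
      \<not> (\<alpha> \<inter> (\<beta> O (\<alpha> \<inter> \<gamma>) O \<beta>) \<subseteq>
           \<gamma> O (\<alpha> \<inter> \<beta>) O \<gamma> O rt_eval \<chi> \<alpha> \<beta> \<gamma> O \<gamma> O (\<alpha> \<inter> \<beta>) O \<gamma>)"
      by (rule main)
  next
    fix r \<alpha>' \<beta>' \<gamma>'
    assume r: "odd r"
      and cong: "congruence n A4 T \<alpha>'" "congruence n A4 T \<beta>'" "congruence n A4 T \<gamma>'"
      and fails: "\<not> \<alpha>' \<inter> (\<beta>' O (\<alpha>' \<inter> \<gamma>') O \<beta>') \<subseteq> alt (\<alpha>' \<inter> \<beta>') (\<alpha>' \<inter> \<gamma>') r"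
    define \<chi> where "\<chi> = alt_term (Meet VarA VarB) (Meet VarA VarG) (r - 1)"
    \<comment> \<open>The term is evaluated at two types, on the product here and on
      \<open>A4\<close> below; oddness gives r > 0, so that Suc (r - 1) = r.\<close>
    have \<chi>: "rt_eval \<chi> \<alpha> \<beta> \<gamma> = alt (\<alpha> \<inter> \<beta>) (\<alpha> \<inter> \<gamma>) r"
      for \<alpha> \<beta> \<gamma> :: "((nat \<times> nat \<times> nat \<times> 'a) \<times> (nat \<times> nat \<times> nat \<times> 'a)) set"
      using odd_pos[OF r] by (simp add: \<chi>_def rt_eval_alt_term)
    have \<chi>': "rt_eval \<chi> \<alpha>' \<beta>' \<gamma>' = alt (\<alpha>' \<inter> \<beta>') (\<alpha>' \<inter> \<gamma>') r"
      using odd_pos[OF r] by (simp add: \<chi>_def rt_eval_alt_term)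
    \<comment> \<open>Weakening the four outer factors \<alpha> \<inter> \<gamma> to \<gamma> only
      enlarges the right-hand side, so failure of the larger inclusion suffices.\<close>
    have sub: "alt (\<alpha> \<inter> \<gamma>) (\<alpha> \<inter> \<beta>) (r + 6) \<subseteq>
        \<gamma> O (\<alpha> \<inter> \<beta>) O \<gamma> O rt_eval \<chi> \<alpha> \<beta> \<gamma> O \<gamma> O (\<alpha> \<inter> \<beta>) O \<gamma>"
      for \<alpha> \<beta> \<gamma> :: "((nat \<times> nat \<times> nat \<times> 'a) \<times> (nat \<times> nat \<times> nat \<times> 'a)) set"
      unfolding alt_add_six[OF r] \<chi> by (intro relcomp_mono) auto
    from main[OF cong, of \<chi>] fails show "\<exists>a\<in>A4. \<exists>d\<in>A4. \<exists>\<alpha> \<beta> \<gamma>.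
      congruence n (Bset A4 a d) (prod_op n T) \<alpha> \<and>
      congruence n (Bset A4 a d) (prod_op n T) \<beta> \<and>
      congruence n (Bset A4 a d) (prod_op n T) \<gamma> \<and>
      \<not> (\<alpha> \<inter> (\<beta> O (\<alpha> \<inter> \<gamma>) O \<beta>) \<subseteq> alt (\<alpha> \<inter> \<gamma>) (\<alpha> \<inter> \<beta>) (r + 6))"
      unfolding \<chi>' using sub by (meson subset_trans)
  qed
qed

end
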